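(* Let $0<\tau_0\le\tau_1<1$. Suppose $\mathbb{P}$ and $\mathbb{Q}$ each take the following form: to sample $Y\sim\mathbb{P}$ (or $Y\sim\mathbb{Q}$, respectively), first sample $X\in\mathbb{R}^N$ from an arbitrary prior $\mathbb{P}_X$ (or $\mathbb{Q}_X$, respectively) supported on $[\tau_0,\tau_1]^N$, then sample $Y\in\{0,1\}^N$ with entries conditionally independent given $X$ and $\mathbb{E}[Y_i\mid X]=X_i$. Define $r_\alpha\in\mathbb{R}$ for $\alpha\in\mathbb{N}^N$ recursively by $$r_\alpha=\mathbb{E}_{\mathbb{P}}[X^\alpha]-\sum_{0\le\beta\lneq\alpha}r_\beta\binom{\alpha}{\beta}\mathbb{E}_{\mathbb{Q}}[X^{\alpha-\beta}].$$ Then $$\mathsf{Adv}_{\le D}(\mathbb{P},\mathbb{Q})\le\sqrt{\sum_{\alpha\in\{0,1\}^N,\ |\alpha|\le D}\frac{r_\alpha^2}{(\tau_0(1-\tau_1))^{|\alpha|}}}.$$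
   Context: $\mathbb{N}=\{0,1,2,\dots\}$. For $\alpha,\beta\in\mathbb{N}^N$: $|\alpha|=\sum_i\alpha_i$, $\binom{\alpha}{\beta}=\prod_i\binom{\alpha_i}{\beta_i}$, $X^\alpha=\prod_iX_i^{\alpha_i}$; $\beta\le\alpha$ means $\beta_i\le\alpha_i$ for all $i$, and $\beta\lneq\alpha$ means $\beta\le\alpha$ and $\beta\ne\alpha$. In particular $r_0=1$. For an integer $D\ge0$, $$\mathsf{Adv}_{\le D}(\mathbb{P},\mathbb{Q}):=\sup_{f}\frac{\mathbb{E}_{\mathbb{P}}[f(Y)]}{\sqrt{\mathbb{E}_{\mathbb{Q}}[f(Y)^2]}},$$ where $f$ ranges over polynomials $\mathbb{R}^N\to\mathbb{R}$ of degree at most $D$ (with $\mathbb{E}_{\mathbb{Q}}[f(Y)^2]\neq0$). *)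

theory Defs
  imports "HOL-Probability.Probability"
begin

text \<open>
  Vectors in \<open>\<real>\<^sup>N\<close> are elements of \<^typ>\<open>real ^ 'n\<close> and multi-indices in \<open>\<nat>\<^sup>N\<close> are functions
  \<^typ>\<open>'n \<Rightarrow> nat\<close>, for a finite index type \<open>'n\<close> with \<open>N\<close> elements; the order on
  multi-indices is the library's pointwise order on functions.
\<close>

definition mi_size :: "('n::finite \<Rightarrow> nat) \<Rightarrow> nat" where
  "mi_size \<alpha> = (\<Sum>i\<in>UNIV. \<alpha> i)"

definition mi_binom :: "('n::finite \<Rightarrow> nat) \<Rightarrow> ('n \<Rightarrow> nat) \<Rightarrow> nat" where
  "mi_binom \<alpha> \<beta> = (\<Prod>i\<in>UNIV. \<alpha> i choose \<beta> i)"

definition monomial :: "('n::finite \<Rightarrow> nat) \<Rightarrow> real ^ 'n \<Rightarrow> real" where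
  "monomial \<alpha> x = (\<Prod>i\<in>UNIV. (x $ i) ^ \<alpha> i)"

definition poly_deg_le :: "nat \<Rightarrow> (real ^ 'n::finite \<Rightarrow> real) set" where
  "poly_deg_le D = {f. \<exists>c. f = (\<lambda>x. \<Sum>\<alpha> | mi_size \<alpha> \<le> D. c \<alpha> * monomial \<alpha> x)}"

lemma finite_mi_size_le: "finite {\<alpha>::'n::finite \<Rightarrow> nat. mi_size \<alpha> \<le> D}"
proof (rule finite_subset)
  show "{\<alpha>::'n \<Rightarrow> nat. mi_size \<alpha> \<le> D} \<subseteq> Pi\<^sub>E UNIV (\<lambda>_. {..D})"
  proof
    fix \<alpha> :: "'n \<Rightarrow> nat" assume "\<alpha> \<in> {\<alpha>. mi_size \<alpha> \<le> D}"
    moreover have "\<alpha> i \<le> mi_size \<alpha>" for i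
      unfolding mi_size_def by (rule member_le_sum) auto
    ultimately have "\<alpha> i \<le> D" for i by (metis mem_Collect_eq order_trans)
    thus "\<alpha> \<in> Pi\<^sub>E UNIV (\<lambda>_. {..D})" by (simp add: PiE_iff)
  qed
qed (simp add: finite_PiE)

text \<open>
  The arguments are the laws of \<open>Y\<close>. The supremum is taken in \<^typ>\<open>ereal\<close>, where it always
  exists; a bound by a real number therefore includes the claim that the ratios are bounded above.
\<close>

definition Adv :: "nat \<Rightarrow> (real ^ 'n::finite) measure \<Rightarrow> (real ^ 'n) measure \<Rightarrow> ereal" where
  "Adv D P Q = (SUP f \<in> {f \<in> poly_deg_le D. (\<integral>y. (f y)\<^sup>2 \<partial>Q) \<noteq> 0}.
     ereal ((\<integral>y. f y \<partial>P) / sqrt (\<integral>y. (f y)\<^sup>2 \<partial>Q)))"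

text \<open>
  The conditional law of \<open>Y\<close> given \<open>X = x\<close>: a vector of independent Bernoulli entries with means
  \<open>x\<^sub>i\<close>, regarded as a Borel measure on \<open>\<real>\<^sup>N\<close> concentrated on \<open>{0,1}\<^sup>N\<close>. The library's
  \<^const>\<open>bernoulli_pmf\<close> truncates its parameter to \<open>[0,1]\<close>, so \<open>x\<close> is meant to lie in the unit cube.
\<close>

definition bern_kernel :: "real ^ 'n::finite \<Rightarrow> (real ^ 'n) measure" where
  "bern_kernel x = distr (measure_pmf (Pi_pmf UNIV False (\<lambda>i. bernoulli_pmf (x $ i)))) borel
     (\<lambda>b. \<chi> i. of_bool (b i))"

text \<open>The law of \<open>Y\<close>: draw \<open>X\<close> from the prior, then \<open>Y\<close> from the kernel at \<open>X\<close>.\<close>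

definition bern_mixture :: "(real ^ 'n::finite) measure \<Rightarrow> (real ^ 'n) measure" where
  "bern_mixture PX = PX \<bind> bern_kernel"

text \<open>
  The monadic bind is only meaningful for a measurable kernel:
\<close>

lemma measurable_bern_kernel:
  "(bern_kernel :: real ^ 'n::finite \<Rightarrow> _) \<in> borel \<rightarrow>\<^sub>M subprob_algebra borel"
proof -
  let ?p = "\<lambda>x::real^'n. measure_pmf (Pi_pmf UNIV False (\<lambda>i. bernoulli_pmf (x $ i)))"
  have fin: "finite A" for A :: "('n \<Rightarrow> bool) set" by (rule finite)
  have pmf_b: "pmf (bernoulli_pmf q) b
      = (if b then min 1 (max 0 q) else 1 - min 1 (max 0 q))" for q b
    by (cases b) (auto simp: bernoulli_pmf.rep_eq)
  have "?p \<in> borel \<rightarrow>\<^sub>M subprob_algebra (count_space UNIV)"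
  proof (rule measurable_subprob_algebra)
    show "subprob_space (?p x)" for x by unfold_locales auto
    show "(\<lambda>x. emeasure (?p x) A) \<in> borel_measurable borel" for A
      unfolding emeasure_measure_pmf_finite[OF fin] by (simp add: pmf_Pi pmf_b)
  qed simp
  moreover have "(\<lambda>b::'n \<Rightarrow> bool. (\<chi> i. of_bool (b i))) \<in> count_space UNIV \<rightarrow>\<^sub>M (borel :: (real^'n) measure)"
    by simp
  ultimately show ?thesis
    unfolding bern_kernel_def by (rule measurable_compose[OF _ measurable_distr])
qed

text \<open>
  The recursion for \<open>r\<^sub>\<alpha>\<close> in terms of the two priors; the expectations of \<open>X\<^sup>\<alpha>\<close> under the joint
  laws of \<open>(X, Y)\<close> are the moments of the priors.
\<close>

function r_coeff :: "(real ^ 'n::finite) measure \<Rightarrow> (real ^ 'n) measure \<Rightarrow> ('n \<Rightarrow> nat) \<Rightarrow> real" where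
  "r_coeff PX QX \<alpha> = (\<integral>x. monomial \<alpha> x \<partial>PX) -
     (\<Sum>\<beta> | \<beta> \<le> \<alpha> \<and> \<beta> \<noteq> \<alpha>.
        r_coeff PX QX \<beta> * real (mi_binom \<alpha> \<beta>) * (\<integral>x. monomial (\<lambda>i. \<alpha> i - \<beta> i) x \<partial>QX))"
  by pat_completeness auto
termination
proof (relation "Wellfounded.measure (\<lambda>(PX, QX, \<alpha>). mi_size \<alpha>)")
  fix PX QX :: "(real ^ 'n) measure" and \<alpha> \<beta> :: "'n \<Rightarrow> nat"
  assume "\<beta> \<in> {\<beta>. \<beta> \<le> \<alpha> \<and> \<beta> \<noteq> \<alpha>}"
  hence le: "\<And>i. \<beta> i \<le> \<alpha> i" and "\<exists>i. \<beta> i \<noteq> \<alpha> i" by (auto simp: le_fun_def)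
  then obtain i where "\<beta> i < \<alpha> i" by (meson order_le_imp_less_or_eq)
  hence "mi_size \<beta> < mi_size \<alpha>" unfolding mi_size_def
    by (intro sum_strict_mono_ex1) (auto intro: le)
  thus "((PX, QX, \<beta>), (PX, QX, \<alpha>)) \<in> Wellfounded.measure (\<lambda>(PX, QX, \<alpha>). mi_size \<alpha>)" by simp
qed simp

declare r_coeff.simps [simp del]

end

theory Submission
  imports Defs
begin

text \<open>
  On the cube every polynomial is multilinear, \<open>f(y) = \<Sum>\<^sub>S c\<^sub>S y\<^sup>S\<close>. Put
  \<open>g\<^sub>T(x) = \<Sum>\<^bsub>S \<supseteq> T\<^esub> c\<^sub>S x\<^bsup>S - T\<^esup>\<close>, the mixed partial derivative of the multilinear extension.
  Given \<open>X = x\<close>, the functions \<open>\<Prod>\<^bsub>i \<in> T\<^esub> (Y\<^sub>i - x\<^sub>i)\<close> are orthogonal, \<open>f(Y)\<close> has coefficients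
  \<open>g\<^sub>T(x)\<close> in this basis, and so
  \<open>E[f(Y)\<^sup>2 | X = x] = \<Sum>\<^sub>T g\<^sub>T(x)\<^sup>2 \<Prod>\<^bsub>i \<in> T\<^esub> x\<^sub>i (1 - x\<^sub>i) \<ge> \<Sum>\<^sub>T (\<tau>\<^sub>0 (1 - \<tau>\<^sub>1))\<^bsup>|T|\<^esup> g\<^sub>T(x)\<^sup>2\<close>.
  The recursion for \<open>r\<close> says exactly that \<open>E\<^sub>P f(Y) = \<Sum>\<^sub>T r\<^sub>T E\<^sub>Q g\<^sub>T(X)\<close>; the bound follows by
  Cauchy-Schwarz and \<open>(E\<^sub>Q g\<^sub>T)\<^sup>2 \<le> E\<^sub>Q g\<^sub>T\<^sup>2\<close>.
\<close>

section \<open>Integration against the Bernoulli kernel and its mixtures\<close>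

lemma AE_bern_kernelI:
  assumes "Measurable.pred borel P" "\<And>b. P (\<chi> i. of_bool (b i))"
  shows "AE y in bern_kernel x. P y"
  unfolding bern_kernel_def using assms by (subst AE_distr_iff) auto

lemma AE_bern_kernel_cube: "AE y in bern_kernel x. \<forall>i. y $ i \<in> {0, 1}"
  by (rule AE_bern_kernelI) auto

lemma sets_bern_kernel [simp, measurable_cong]: "sets (bern_kernel x) = sets borel"
  by (simp add: bern_kernel_def)

lemma prob_space_bern_kernel: "prob_space (bern_kernel x)"
  unfolding bern_kernel_def by (rule prob_space.prob_space_distr) (auto intro: prob_space_measure_pmf)

lemma integrable_bern_kernel:
  fixes g :: "real ^ 'n::finite \<Rightarrow> real"
  assumes "g \<in> borel_measurable borel"
  shows "integrable (bern_kernel x) g"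
  unfolding bern_kernel_def using assms
  by (subst integrable_distr_eq) (auto intro!: integrable_measure_pmf_finite)

text \<open>Independence of the coordinates: padding the product with factors 1 outside
  \<open>S\<close> makes it run over all indices, and the expectation factorises. The cube
  hypothesis ensures that \<open>bernoulli_pmf\<close> does not truncate its parameter.\<close>

lemma integral_bern_kernel_prod:
  fixes x :: "real ^ 'n::finite"
  assumes x: "\<And>i. x $ i \<in> {0..1}"
  shows "(\<integral>y. (\<Prod>i\<in>S. y $ i) \<partial>bern_kernel x) = (\<Prod>i\<in>S. x $ i)"
proof -
  have "(\<integral>y. (\<Prod>i\<in>S. y $ i) \<partial>bern_kernel x)
      = measure_pmf.expectation (Pi_pmf UNIV False (\<lambda>i. bernoulli_pmf (x $ i)))
          (\<lambda>b. \<Prod>i\<in>UNIV. if i \<in> S then of_bool (b i) else 1)"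
    unfolding bern_kernel_def
    by (subst integral_distr) (auto simp: prod.If_cases)
  also have "\<dots> = (\<Prod>i\<in>UNIV. measure_pmf.expectation (bernoulli_pmf (x $ i))
                     (\<lambda>v. if i \<in> S then of_bool v else 1))"
    by (rule expectation_prod_Pi_pmf) (auto intro!: integrable_measure_pmf_finite)
  also have "\<dots> = (\<Prod>i\<in>UNIV. if i \<in> S then x $ i else 1)"
    using x by (intro prod.cong) auto
  finally show ?thesis by (simp add: prod.If_cases)
qed

text \<open>The tower property. No integrability of \<open>g\<close> is assumed: every kernel lives
  on the finite cube, where \<open>g\<close> is bounded.\<close>

lemma integral_bern_mixture:
  fixes g :: "real ^ 'n::finite \<Rightarrow> real"
  assumes M: "prob_space M" "sets M = sets borel" and g [measurable]: "g \<in> borel_measurable borel"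
  shows "(\<integral>y. g y \<partial>bern_mixture M) = (\<integral>x. (\<integral>y. g y \<partial>bern_kernel x) \<partial>M)"
proof -
  interpret prob_space M by (rule M)
  have [measurable_cong]: "sets M = sets borel" by (rule M)
  have ker [measurable]: "bern_kernel \<in> M \<rightarrow>\<^sub>M subprob_algebra borel"
    using measurable_bern_kernel measurable_cong_sets[OF M(2) refl] by blast
  define B where "B = (MAX b. \<bar>g (\<chi> i. of_bool (b i))\<bar>)"
  \<comment> \<open>\<open>integral_bind\<close> needs a bounded integrand, so \<open>g\<close> is truncated at its maximum over the cube.\<close>
  define h where "h = (\<lambda>y. max (- B) (min B (g y)))"
  have [measurable]: "h \<in> borel_measurable borel" by (simp add: h_def)
  have B: "\<bar>g (\<chi> i. of_bool (b i))\<bar> \<le> B" for b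
    unfolding B_def by (rule Max_ge) auto
  have "g (\<chi> i. of_bool (b i)) = h (\<chi> i. of_bool (b i))" for b
    using B[of b] by (simp add: h_def abs_le_iff min_def max_def)
  hence eq: "AE y in bern_kernel x. g y = h y" for x
    by (intro AE_bern_kernelI) auto
  have sets: "sets (bern_mixture M) = sets borel"
    unfolding bern_mixture_def by (rule sets_bind) (auto simp: not_empty)
  \<comment> \<open>Clamping to \<open>[-B, B]\<close> gives absolute values at most
    \<open>B\<close> only when this interval is nonempty.\<close>
  have "0 \<le> B"
    using B by (meson abs_ge_zero order_trans)
  have "(\<integral>y. g y \<partial>bern_mixture M) = (\<integral>y. h y \<partial>bern_mixture M)"
  proof (rule integral_cong_AE)
    show "AE y in bern_mixture M. g y = h y"
      unfolding bern_mixture_def using eq by (subst AE_bind[where B = borel]) auto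
  qed (simp_all add: measurable_cong_sets[OF sets refl])
  also have "\<dots> = (\<integral>x. (\<integral>y. h y \<partial>bern_kernel x) \<partial>M)"
    unfolding bern_mixture_def
  proof (rule integral_bind[where K = borel and B = B and B' = 1])
    show "AE x in M. emeasure (bern_kernel x) (space (bern_kernel x)) \<le> ennreal 1"
      by (simp add: prob_space.emeasure_space_1[OF prob_space_bern_kernel])
    show "\<bar>h x\<bar> \<le> B" for x using \<open>0 \<le> B\<close> by (auto simp: h_def)
  qed (auto intro: finite_measure_axioms)
  also have "\<dots> = (\<integral>x. (\<integral>y. g y \<partial>bern_kernel x) \<partial>M)"
    by (rule Bochner_Integration.integral_cong[OF refl], rule integral_cong_AE)
       (use eq in \<open>auto simp: eq_commute\<close>)
  finally show ?thesis .
qed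

text \<open>Given \<open>X = x\<close>, a squarefree monomial in \<open>Y\<close> has mean equal to
  the same monomial in \<open>x\<close>, so the multilinear form of \<open>f\<close> passes from
  \<open>Y\<close> to the prior. The free index set \<open>K\<close> with sets \<open>A k\<close>
  serves both \<open>f\<close> (indexed by sets) and its square (indexed by pairs of sets).\<close>

lemma integral_bern_mixture_multilinear:
  fixes f :: "real ^ 'n::finite \<Rightarrow> real" and c :: "'a \<Rightarrow> real" and A :: "'a \<Rightarrow> 'n set"
  assumes M: "prob_space M" "sets M = sets borel" "AE x in M. \<forall>i. x $ i \<in> {0..1}"
    and f [measurable]: "f \<in> borel_measurable borel"
    and eq: "\<And>y. (\<And>i. y $ i \<in> {0, 1}) \<Longrightarrow> f y = (\<Sum>k\<in>K. c k * (\<Prod>i\<in>A k. y $ i))"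
  shows "(\<integral>y. f y \<partial>bern_mixture M) = (\<integral>x. (\<Sum>k\<in>K. c k * (\<Prod>i\<in>A k. x $ i)) \<partial>M)"
proof -
  have [measurable_cong]: "sets M = sets borel" by (rule M)
  have ker: "bern_kernel \<in> M \<rightarrow>\<^sub>M subprob_algebra borel"
    using measurable_bern_kernel measurable_cong_sets[OF M(2) refl] by blast
  have ker_eq: "(\<integral>y. f y \<partial>bern_kernel x) = (\<Sum>k\<in>K. c k * (\<Prod>i\<in>A k. x $ i))"
    if "\<forall>i. x $ i \<in> {0..1}" for x
  proof -
    have "(\<integral>y. f y \<partial>bern_kernel x) = (\<integral>y. (\<Sum>k\<in>K. c k * (\<Prod>i\<in>A k. y $ i)) \<partial>bern_kernel x)"
      using AE_bern_kernel_cube[of x] by (intro integral_cong_AE) (auto elim!: eventually_mono intro: eq)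
    also have "\<dots> = (\<Sum>k\<in>K. c k * (\<integral>y. (\<Prod>i\<in>A k. y $ i) \<partial>bern_kernel x))"
      by (subst Bochner_Integration.integral_sum) (auto intro!: integrable_bern_kernel)
    finally show ?thesis using that by (simp add: integral_bern_kernel_prod)
  qed
  have "(\<integral>y. f y \<partial>bern_mixture M) = (\<integral>x. (\<integral>y. f y \<partial>bern_kernel x) \<partial>M)"
    by (rule integral_bern_mixture[OF M(1,2) f])
  also have "\<dots> = (\<integral>x. (\<Sum>k\<in>K. c k * (\<Prod>i\<in>A k. x $ i)) \<partial>M)"
  proof (rule integral_cong_AE)
    show "(\<lambda>x. \<integral>y. f y \<partial>bern_kernel x) \<in> borel_measurable M"
      by (rule measurable_compose[OF ker integral_measurable_subprob_algebra]) (rule f)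
  qed (use M(3) in \<open>auto elim!: eventually_mono simp: ker_eq\<close>)
  finally show ?thesis .
qed

section \<open>Multilinear form on the cube and Parseval's identity\<close>

text \<open>Positive powers of 0 and 1 are idempotent, so a monomial depends only on its support,
  whose size is at most the degree. Coefficients with equal support are added up.\<close>

lemma poly_deg_le_multilinear_on_cube:
  fixes f :: "real ^ 'n::finite \<Rightarrow> real"
  assumes "f \<in> poly_deg_le D"
  obtains c where "\<And>y. (\<And>i. y $ i \<in> {0, 1}) \<Longrightarrow>
    f y = (\<Sum>S | card S \<le> D. c S * (\<Prod>i\<in>S. y $ i))"
proof -
  let ?K = "{\<alpha>::'n \<Rightarrow> nat. mi_size \<alpha> \<le> D}" and ?supp = "\<lambda>\<alpha>::'n \<Rightarrow> nat. {i. \<alpha> i \<noteq> 0}"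
  from assms obtain a where a: "f = (\<lambda>x. \<Sum>\<alpha> | mi_size \<alpha> \<le> D. a \<alpha> * monomial \<alpha> x)"
    unfolding poly_deg_le_def by auto
  define c where "c = (\<lambda>S. \<Sum>\<alpha> | \<alpha> \<in> ?K \<and> ?supp \<alpha> = S. a \<alpha>)"
  have supp: "card (?supp \<alpha>) \<le> mi_size \<alpha>" for \<alpha> :: "'n \<Rightarrow> nat"
  proof -
    have "card (?supp \<alpha>) = (\<Sum>i\<in>?supp \<alpha>. 1)" by simp
    also have "\<dots> \<le> (\<Sum>i\<in>?supp \<alpha>. \<alpha> i)" by (intro sum_mono) auto
    also have "\<dots> \<le> mi_size \<alpha>" unfolding mi_size_def by (intro sum_mono2) auto
    finally show ?thesis .
  qed
  have "f y = (\<Sum>S | card S \<le> D. c S * (\<Prod>i\<in>S. y $ i))" if y: "\<And>i. y $ i \<in> {0, 1}" for y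
  proof -
    have mon: "monomial \<alpha> y = (\<Prod>i\<in>?supp \<alpha>. y $ i)" for \<alpha>
    proof -
      have "monomial \<alpha> y = (\<Prod>i\<in>?supp \<alpha>. (y $ i) ^ \<alpha> i)"
        unfolding monomial_def by (intro prod.mono_neutral_right) auto
      also have "\<dots> = (\<Prod>i\<in>?supp \<alpha>. y $ i)"
      proof (intro prod.cong refl)
        fix i assume "i \<in> ?supp \<alpha>"
        thus "(y $ i) ^ \<alpha> i = y $ i" using y[of i] by auto
      qed
      finally show ?thesis .
    qed
    have "f y = (\<Sum>\<alpha>\<in>?K. a \<alpha> * (\<Prod>i\<in>?supp \<alpha>. y $ i))"
      by (simp add: a mon)
    also have "\<dots> = (\<Sum>S | card S \<le> D. \<Sum>\<alpha> | \<alpha> \<in> ?K \<and> ?supp \<alpha> = S. a \<alpha> * (\<Prod>i\<in>?supp \<alpha>. y $ i))"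
    proof (rule sum.group[symmetric])
      show "?supp ` ?K \<subseteq> {S. card S \<le> D}" using supp order_trans by blast
    qed (auto intro: finite_mi_size_le)
    also have "\<dots> = (\<Sum>S | card S \<le> D. c S * (\<Prod>i\<in>S. y $ i))"
      unfolding c_def sum_distrib_right by (intro sum.cong) auto
    finally show ?thesis .
  qed
  thus ?thesis by (rule that)
qed

lemma borel_measurable_poly_deg_le:
  assumes "f \<in> poly_deg_le D"
  shows "f \<in> borel_measurable borel"
  using assms unfolding poly_deg_le_def monomial_def by auto

text \<open>
  Parseval's identity for the conditional law given \<open>X = x\<close>. The left-hand side is the second moment
  of \<open>\<Sum>\<^sub>S c\<^sub>S Y\<^sup>S\<close>, since \<open>Y\<^sup>S Y\<^sup>T = Y\<^bsup>S \<union> T\<^esup>\<close> on the cube.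
\<close>

lemma bernoulli_parseval:
  fixes c :: "'n::finite set \<Rightarrow> real" and x :: "'n \<Rightarrow> real"
  assumes K: "finite K"
  shows "(\<Sum>S\<in>K. \<Sum>T\<in>K. c S * c T * (\<Prod>i\<in>S \<union> T. x i)) =
    (\<Sum>U\<in>UNIV. (\<Prod>i\<in>U. x i * (1 - x i)) * (\<Sum>S | S \<in> K \<and> U \<subseteq> S. c S * (\<Prod>i\<in>S - U. x i))\<^sup>2)"
proof -
  let ?p = "\<lambda>S. \<Prod>i\<in>S. x i" and ?v = "\<lambda>U. \<Prod>i\<in>U. x i * (1 - x i)"
  \<comment> \<open>The product of two monomials expanded in the orthogonal basis: only the sets
    \<open>U\<close> common to both contribute.\<close>
  have key: "?p (S \<union> T) = (\<Sum>U | U \<subseteq> S \<and> U \<subseteq> T. ?v U * (?p (S - U) * ?p (T - U)))" for S T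
  proof -
    have split: "?p (S - U) * ?p (T - U) = ?p (S - T) * ?p (T - S) * (\<Prod>i\<in>S \<inter> T - U. x i * x i)"
      if "U \<subseteq> S \<inter> T" for U
    proof -
      have "?p (S - U) = ?p (S - T) * ?p (S \<inter> T - U)"
        using that by (subst prod.union_disjoint[symmetric]) (auto intro!: prod.cong)
      moreover have "?p (T - U) = ?p (T - S) * ?p (S \<inter> T - U)"
        using that by (subst prod.union_disjoint[symmetric]) (auto intro!: prod.cong)
      ultimately show ?thesis by (simp add: prod.distrib mult_ac)
    qed
    have "?p (S \<union> T) = ?p (S - T) * ?p (T - S) * ?p (S \<inter> T)"
    proof -
      have "?p (((S - T) \<union> (T - S)) \<union> (S \<inter> T)) = ?p (S - T) * ?p (T - S) * ?p (S \<inter> T)"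
        by (subst prod.union_disjoint, simp, simp, blast, subst prod.union_disjoint) auto
      moreover have "((S - T) \<union> (T - S)) \<union> (S \<inter> T) = S \<union> T" by auto
      ultimately show ?thesis by simp
    qed
    \<comment> \<open>Each shared coordinate has second moment \<open>x i\<close>, which splits into
      variance plus squared mean; \<open>U\<close> collects the coordinates where the variance is
      chosen.\<close>
    also have "?p (S \<inter> T) = (\<Prod>i\<in>S \<inter> T. x i * (1 - x i) + x i * x i)"
      by (simp add: algebra_simps)
    also have "\<dots> = (\<Sum>U\<in>Pow (S \<inter> T). ?v U * (\<Prod>i\<in>S \<inter> T - U. x i * x i))"
      by (rule prod_add) simp
    also have "?p (S - T) * ?p (T - S) * \<dots> = (\<Sum>U\<in>Pow (S \<inter> T). ?v U * (?p (S - U) * ?p (T - U)))"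
      unfolding sum_distrib_left by (intro sum.cong) (auto simp: split)
    also have "Pow (S \<inter> T) = {U. U \<subseteq> S \<and> U \<subseteq> T}" by auto
    finally show ?thesis .
  qed
  \<comment> \<open>Writing the condition on \<open>U\<close> as an \<open>if\<close> makes the
    ranges independent, so the sum over \<open>U\<close> can move outside; for fixed
    \<open>U\<close> the condition splits between \<open>S\<close> and \<open>T\<close>, and the
    double sum is a square.\<close>
  have "(\<Sum>S\<in>K. \<Sum>T\<in>K. c S * c T * ?p (S \<union> T))
      = (\<Sum>S\<in>K. \<Sum>T\<in>K. \<Sum>U\<in>UNIV. if U \<subseteq> S \<and> U \<subseteq> T
           then ?v U * ((c S * ?p (S - U)) * (c T * ?p (T - U))) else 0)"
    by (intro sum.cong refl, subst key) (simp add: sum.If_cases sum_distrib_left mult_ac)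
  also have "\<dots> = (\<Sum>U\<in>UNIV. \<Sum>S\<in>K. \<Sum>T\<in>K. if U \<subseteq> S \<and> U \<subseteq> T
           then ?v U * ((c S * ?p (S - U)) * (c T * ?p (T - U))) else 0)"
    by (simp only: sum.swap[of _ UNIV K])
  also have "\<dots> = (\<Sum>U\<in>UNIV. \<Sum>S | S \<in> K \<and> U \<subseteq> S. \<Sum>T | T \<in> K \<and> U \<subseteq> T.
           ?v U * ((c S * ?p (S - U)) * (c T * ?p (T - U))))"
    by (simp only: sum.inter_filter[OF K]) (auto intro!: sum.cong sum.neutral)
  also have "\<dots> = (\<Sum>U\<in>UNIV. ?v U * (\<Sum>S | S \<in> K \<and> U \<subseteq> S. c S * ?p (S - U))\<^sup>2)"
    unfolding power2_eq_square sum_product by (simp only: sum_distrib_left)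
  finally show ?thesis .
qed

section \<open>Zero-one multi-indices as indicators of sets, and the recursion for
  \<open>r_coeff\<close>\<close>

lemma mi_size_indicator: "mi_size (indicator S) = card S"
  by (simp add: mi_size_def indicator_def sum.If_cases)

lemma monomial_indicator: "monomial (indicator (S :: 'n::finite set)) = (\<lambda>x. \<Prod>i\<in>S. x $ i)"
proof
  fix x :: "real ^ 'n"
  have "monomial (indicator S) x = (\<Prod>i\<in>UNIV. if i \<in> S then x $ i else 1)"
    unfolding monomial_def by (intro prod.cong) auto
  thus "monomial (indicator S) x = (\<Prod>i\<in>S. x $ i)" by (simp add: prod.If_cases)
qed

lemma inj_indicator_nat: "inj (indicator :: 'n set \<Rightarrow> 'n \<Rightarrow> nat)"
proof (rule injI)
  fix S T :: "'n set" assume "indicator S = (indicator T :: 'n \<Rightarrow> nat)"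
  hence "indicator S i = (indicator T i :: nat)" for i by simp
  thus "S = T" by (metis indicator_eq_1_iff subsetI subset_antisym)
qed

lemma zero_one_multi_index: "(\<forall>i. \<alpha> i \<in> {0, 1}) \<longleftrightarrow> (\<exists>S. \<alpha> = (indicator S :: 'n \<Rightarrow> nat))"
proof
  assume a: "\<forall>i. \<alpha> i \<in> {0, 1}"
  have "\<alpha> = indicator {i. \<alpha> i = 1}"
  proof
    fix i show "\<alpha> i = indicator {i. \<alpha> i = 1} i" using a[rule_format, of i] by (auto simp: indicator_def)
  qed
  thus "\<exists>S. \<alpha> = (indicator S :: 'n \<Rightarrow> nat)" ..
qed (auto simp: indicator_def)

lemma le_indicator_iff: "\<beta> \<le> indicator S \<longleftrightarrow> (\<exists>T. T \<subseteq> S \<and> \<beta> = (indicator T :: 'n \<Rightarrow> nat))"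
proof
  assume le: "\<beta> \<le> indicator S"
  have le1: "\<beta> i \<le> indicator S i" for i using le by (simp add: le_fun_def)
  have "\<beta> i \<in> {0, 1}" for i using le1[of i] by (cases "i \<in> S") auto
  then obtain T where T: "\<beta> = indicator T" using zero_one_multi_index by blast
  have "T \<subseteq> S" using le1 unfolding T by (auto simp: indicator_def split: if_splits)
  with T show "\<exists>T. T \<subseteq> S \<and> \<beta> = indicator T" by blast
qed (auto simp: le_fun_def indicator_def)

text \<open>The recursion solved for the moment under \<open>PX\<close>. Below an indicator there
  are only indicators of subsets, and all binomials are 1; the term \<open>T = S\<close> carries the
  factor 1 because \<open>QX\<close> has total mass 1.\<close>

lemma moment_indicator_eq_sum_r_coeff:
  fixes PX QX :: "(real ^ 'n::finite) measure"
  assumes "prob_space QX"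
  shows "(\<integral>x. (\<Prod>i\<in>S. x $ i) \<partial>PX) =
    (\<Sum>T | T \<subseteq> S. r_coeff PX QX (indicator T) * (\<integral>x. (\<Prod>i\<in>S - T. x $ i) \<partial>QX))"
proof -
  let ?t = "\<lambda>T. r_coeff PX QX (indicator T) * (\<integral>x. (\<Prod>i\<in>S - T. x $ i) \<partial>QX)"
  have binom: "mi_binom (indicator S) (indicator T) = 1" if "T \<subseteq> S" for T
    using that unfolding mi_binom_def by (intro prod.neutral) (auto simp: indicator_def)
  have diff: "(\<lambda>i. indicator S i - indicator T i :: nat) = indicator (S - T)" if "T \<subseteq> S" for T
    using that by (auto simp: indicator_def fun_eq_iff)
  have set: "{\<beta>. \<beta> \<le> indicator S \<and> \<beta> \<noteq> indicator S}
      = (indicator :: _ \<Rightarrow> 'n \<Rightarrow> nat) ` {T. T \<subset> S}"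
    using inj_indicator_nat by (auto simp: le_indicator_iff dest: injD)
  have "r_coeff PX QX (indicator S) = (\<integral>x. (\<Prod>i\<in>S. x $ i) \<partial>PX) - (\<Sum>T | T \<subset> S. ?t T)"
    unfolding r_coeff.simps[of PX QX "indicator S"] set
    by (subst sum.reindex[OF inj_on_subset[OF inj_indicator_nat]])
       (auto simp: binom diff monomial_indicator intro!: sum.cong)
  moreover have "{T. T \<subseteq> S} = insert S {T. T \<subset> S}" by auto
  ultimately show ?thesis by (simp add: prob_space.prob_space[OF assms])
qed

section \<open>Integrability and the bound on the advantage\<close>

lemma integrable_continuous_on_unit_cube:
  fixes g :: "real ^ 'n::finite \<Rightarrow> real"
  assumes M: "prob_space M" "sets M = sets borel" "AE x in M. \<forall>i. x $ i \<in> {0..1}"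
    and g: "continuous_on UNIV g"
  shows "integrable M g"
proof -
  interpret prob_space M by (rule M)
  have "compact (g ` cbox 0 1)"
    using g by (intro compact_continuous_image) (auto intro: continuous_on_subset)
  then obtain B where B: "\<And>x. x \<in> cbox 0 1 \<Longrightarrow> norm (g x) \<le> B"
    by (meson bounded_iff compact_imp_bounded image_eqI)
  show ?thesis
  proof (rule integrable_const_bound)
    show "AE x in M. norm (g x) \<le> B"
      using M(3) by eventually_elim (rule B, simp add: mem_box_cart)
    show "g \<in> borel_measurable M"
      using borel_measurable_continuous_onI[OF g] measurable_cong_sets[OF M(2) refl] by blast
  qed
qed

lemma (in prob_space) expectation_square_le:
  fixes X :: "'a \<Rightarrow> real"
  assumes "integrable M X" "integrable M (\<lambda>x. (X x)\<^sup>2)"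
  shows "(expectation X)\<^sup>2 \<le> expectation (\<lambda>x. (X x)\<^sup>2)"
  using variance_positive[of X] variance_eq[OF assms] by simp

text \<open>The bound for one polynomial, squared and free of division, so that a vanishing second
  moment needs no separate case.\<close>

lemma bern_mixture_advantage:
  fixes PX QX :: "(real ^ 'n::finite) measure" and \<tau>\<^sub>0 \<tau>\<^sub>1 :: real
  assumes \<tau>: "0 < \<tau>\<^sub>0" "\<tau>\<^sub>0 \<le> \<tau>\<^sub>1" "\<tau>\<^sub>1 < 1"
    and PX: "prob_space PX" "sets PX = sets borel" "AE x in PX. \<forall>i. x $ i \<in> {\<tau>\<^sub>0..\<tau>\<^sub>1}"
    and QX: "prob_space QX" "sets QX = sets borel" "AE x in QX. \<forall>i. x $ i \<in> {\<tau>\<^sub>0..\<tau>\<^sub>1}"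
    and f: "f \<in> poly_deg_le D"
  shows "(\<integral>y. f y \<partial>bern_mixture PX)\<^sup>2
    \<le> (\<Sum>S | card S \<le> D. (r_coeff PX QX (indicator S))\<^sup>2 / (\<tau>\<^sub>0 * (1 - \<tau>\<^sub>1)) ^ card S)
       * (\<integral>y. (f y)\<^sup>2 \<partial>bern_mixture QX)"
proof -
  define l where "l = \<tau>\<^sub>0 * (1 - \<tau>\<^sub>1)"
  define K where "K = {S :: 'n set. card S \<le> D}"
  define r where "r = (\<lambda>S. r_coeff PX QX (indicator S))"
  have l: "0 < l" using \<tau> by (simp add: l_def)
  have PX01: "AE x in PX. \<forall>i. x $ i \<in> {0..1}" and QX01: "AE x in QX. \<forall>i. x $ i \<in> {0..1}"
    using PX(3) QX(3) \<tau> by (auto elim!: eventually_mono) (smt (verit))+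
  note intP = integrable_continuous_on_unit_cube[OF PX(1,2) PX01]
  note intQ = integrable_continuous_on_unit_cube[OF QX(1,2) QX01]
  have [measurable]: "f \<in> borel_measurable borel" using f by (rule borel_measurable_poly_deg_le)
  obtain c where c: "\<And>y. (\<And>i. y $ i \<in> {0, 1}) \<Longrightarrow> f y = (\<Sum>S\<in>K. c S * (\<Prod>i\<in>S. y $ i))"
    using poly_deg_le_multilinear_on_cube[OF f] unfolding K_def by metis
  define g where "g = (\<lambda>T (x :: real ^ 'n). \<Sum>S | S \<in> K \<and> T \<subseteq> S. c S * (\<Prod>i\<in>S - T. x $ i))"
  define G where "G = (\<lambda>T. \<integral>x. g T x \<partial>QX)"
  have cont: "continuous_on UNIV (g T)" for T
    unfolding g_def by (intro continuous_intros)

  \<comment> \<open>First moment: the moments under \<open>PX\<close> are expanded by the recursion,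
    and exchanging the sums over \<open>S\<close> and \<open>T\<close> assembles the functions
    \<open>g T\<close>.\<close>
  have first: "(\<integral>y. f y \<partial>bern_mixture PX) = (\<Sum>T\<in>K. r T * G T)"
  proof -
    let ?q = "\<lambda>S. \<integral>x. (\<Prod>i\<in>S. x $ i) \<partial>QX"
    have "(\<integral>y. f y \<partial>bern_mixture PX) = (\<integral>x. (\<Sum>S\<in>K. c S * (\<Prod>i\<in>S. x $ i)) \<partial>PX)"
      by (rule integral_bern_mixture_multilinear[OF PX(1,2) PX01 _ c]) auto
    also have "\<dots> = (\<Sum>S\<in>K. c S * (\<integral>x. (\<Prod>i\<in>S. x $ i) \<partial>PX))"
      by (subst Bochner_Integration.integral_sum) (auto intro!: intP continuous_intros)
    also have "\<dots> = (\<Sum>S\<in>K. \<Sum>T | T \<in> K \<and> T \<subseteq> S. r T * (c S * ?q (S - T)))"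
    proof (intro sum.cong refl)
      \<comment> \<open>\<open>K\<close> is closed under subsets, so requiring
        \<open>T \<in> K\<close> removes nothing.\<close>
      fix S assume "S \<in> K"
      hence "{T. T \<subseteq> S} = {T \<in> K. T \<subseteq> S}"
        unfolding K_def by (auto intro: order_trans[OF card_mono[OF finite]])
      thus "c S * (\<integral>x. (\<Prod>i\<in>S. x $ i) \<partial>PX) = (\<Sum>T | T \<in> K \<and> T \<subseteq> S. r T * (c S * ?q (S - T)))"
        by (simp add: moment_indicator_eq_sum_r_coeff[OF QX(1), of PX S] r_def sum_distrib_left mult_ac)
    qed
    also have "\<dots> = (\<Sum>T\<in>K. \<Sum>S | S \<in> K \<and> T \<subseteq> S. r T * (c S * ?q (S - T)))"
      by (rule sum.swap_restrict) auto
    also have "\<dots> = (\<Sum>T\<in>K. r T * G T)"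
      unfolding G_def g_def
      by (subst Bochner_Integration.integral_sum)
         (auto intro!: intQ continuous_intros simp: sum_distrib_left)
    finally show ?thesis .
  qed

  \<comment> \<open>Second moment: Parseval pointwise in \<open>x\<close>, then the variance bound,
    then Jensen for each \<open>g T\<close>.\<close>
  have second: "(\<Sum>T\<in>K. l ^ card T * (G T)\<^sup>2) \<le> (\<integral>y. (f y)\<^sup>2 \<partial>bern_mixture QX)"
  proof -
    have "(\<integral>y. (f y)\<^sup>2 \<partial>bern_mixture QX)
      = (\<integral>x. (\<Sum>(S, T)\<in>K \<times> K. c S * c T * (\<Prod>i\<in>S \<union> T. x $ i)) \<partial>QX)"
    proof (subst integral_bern_mixture_multilinear[OF QX(1,2) QX01, where K = "K \<times> K"
          and c = "\<lambda>(S, T). c S * c T" and A = "\<lambda>(S, T). S \<union> T"])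
      fix y :: "real ^ 'n" assume y: "\<And>i. y $ i \<in> {0, 1}"
      \<comment> \<open>On the cube each product is the truth value of all its coordinates being
        1.\<close>
      have union: "(\<Prod>i\<in>S. y $ i) * (\<Prod>i\<in>T. y $ i) = (\<Prod>i\<in>S \<union> T. y $ i)" for S T
      proof -
        have "(\<Prod>i\<in>A. y $ i) = of_bool (\<forall>i\<in>A. y $ i = 1)" for A
        proof (cases "\<forall>i\<in>A. y $ i = 1")
          case False
          then obtain j where "j \<in> A" "y $ j = 0" using y by auto
          thus ?thesis using False by (auto intro!: prod_zero)
        qed simp
        thus ?thesis by (auto simp: of_bool_conj[symmetric] ball_Un)
      qed
      thus "(f y)\<^sup>2 = (\<Sum>k\<in>K \<times> K. (case k of (S, T) \<Rightarrow> c S * c T) * (\<Prod>i\<in>(case k of (S, T) \<Rightarrow> S \<union> T). y $ i))"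
        unfolding c[OF y] power2_eq_square sum_product sum.cartesian_product
        by (intro sum.cong refl) (auto simp: union[symmetric] mult_ac)
    qed (auto simp: case_prod_unfold)
    also have "\<dots> = (\<integral>x. (\<Sum>T\<in>UNIV. (\<Prod>i\<in>T. x $ i * (1 - x $ i)) * (g T x)\<^sup>2) \<partial>QX)"
      unfolding g_def by (subst bernoulli_parseval[symmetric]) (auto simp: sum.cartesian_product)
    also have "\<dots> \<ge> (\<integral>x. (\<Sum>T\<in>K. l ^ card T * (g T x)\<^sup>2) \<partial>QX)"
    proof (rule integral_mono_AE)
      show "AE x in QX. (\<Sum>T\<in>K. l ^ card T * (g T x)\<^sup>2)
          \<le> (\<Sum>T\<in>UNIV. (\<Prod>i\<in>T. x $ i * (1 - x $ i)) * (g T x)\<^sup>2)"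
        using QX(3)
      proof eventually_elim
        case (elim x)
        \<comment> \<open>The factors are bounded separately, by \<open>\<tau>\<^sub>0\<close> and
          by \<open>1 - \<tau>\<^sub>1\<close>.\<close>
        have "l \<le> x $ i * (1 - x $ i)" for i
          unfolding l_def using elim \<tau> by (intro mult_mono) (auto intro: order_trans[OF less_imp_le])
        hence le: "l ^ card T \<le> (\<Prod>i\<in>T. x $ i * (1 - x $ i))" for T
          using l prod_mono[of T "\<lambda>_. l" "\<lambda>i. x $ i * (1 - x $ i)"] by simp
        have "(\<Sum>T\<in>K. l ^ card T * (g T x)\<^sup>2) \<le> (\<Sum>T\<in>UNIV. l ^ card T * (g T x)\<^sup>2)"
          using l by (intro sum_mono2) auto
        also have "\<dots> \<le> (\<Sum>T\<in>UNIV. (\<Prod>i\<in>T. x $ i * (1 - x $ i)) * (g T x)\<^sup>2)"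
          by (intro sum_mono mult_right_mono le) auto
        finally show ?case .
      qed
    qed (intro intQ continuous_intros cont)+
    also have "(\<integral>x. (\<Sum>T\<in>K. l ^ card T * (g T x)\<^sup>2) \<partial>QX) = (\<Sum>T\<in>K. l ^ card T * (\<integral>x. (g T x)\<^sup>2 \<partial>QX))"
      by (subst Bochner_Integration.integral_sum) (auto intro!: intQ continuous_intros cont)
    also have "\<dots> \<ge> (\<Sum>T\<in>K. l ^ card T * (G T)\<^sup>2)"
      unfolding G_def using l
      by (intro sum_mono mult_left_mono prob_space.expectation_square_le QX(1) intQ continuous_intros cont)
         auto
    finally show ?thesis .
  qed

  \<comment> \<open>The weight \<open>sqrt (l ^ card T)\<close> is chosen so that the second factor
    of Cauchy-Schwarz is the lower bound in \<open>second\<close>.\<close>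
  have "(\<integral>y. f y \<partial>bern_mixture PX)\<^sup>2
      = (\<Sum>T\<in>K. (r T / sqrt (l ^ card T)) * (sqrt (l ^ card T) * G T))\<^sup>2"
    unfolding first using l by (intro arg_cong[of _ _ "\<lambda>s. s\<^sup>2"] sum.cong) auto
  also have "\<dots> \<le> (\<Sum>T\<in>K. (r T / sqrt (l ^ card T))\<^sup>2) * (\<Sum>T\<in>K. (sqrt (l ^ card T) * G T)\<^sup>2)"
    by (rule Cauchy_Schwarz_ineq_sum)
  also have "\<dots> = (\<Sum>T\<in>K. (r T)\<^sup>2 / l ^ card T) * (\<Sum>T\<in>K. l ^ card T * (G T)\<^sup>2)"
    using l by (simp add: power_divide power_mult_distrib)
  also have "\<dots> \<le> (\<Sum>T\<in>K. (r T)\<^sup>2 / l ^ card T) * (\<integral>y. (f y)\<^sup>2 \<partial>bern_mixture QX)"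
    using l second by (intro mult_left_mono sum_nonneg) auto
  finally show ?thesis unfolding l_def K_def r_def .
qed

theorem proposition2p9:
  fixes PX QX :: "(real ^ 'n::finite) measure" and \<tau>\<^sub>0 \<tau>\<^sub>1 :: real and D :: nat
  assumes "0 < \<tau>\<^sub>0" and "\<tau>\<^sub>0 \<le> \<tau>\<^sub>1" and "\<tau>\<^sub>1 < 1"
    and "prob_space PX" and "sets PX = sets borel"
    and "AE x in PX. \<forall>i. x $ i \<in> {\<tau>\<^sub>0..\<tau>\<^sub>1}"
    and "prob_space QX" and "sets QX = sets borel"
    and "AE x in QX. \<forall>i. x $ i \<in> {\<tau>\<^sub>0..\<tau>\<^sub>1}"
  shows "Adv D (bern_mixture PX) (bern_mixture QX)
    \<le> ereal (sqrt (\<Sum>\<alpha> | (\<forall>i. \<alpha> i \<in> {0, 1}) \<and> mi_size \<alpha> \<le> D.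
        (r_coeff PX QX \<alpha>)\<^sup>2 / (\<tau>\<^sub>0 * (1 - \<tau>\<^sub>1)) ^ mi_size \<alpha>))"
proof -
  let ?R = "\<Sum>S | card S \<le> D. (r_coeff PX QX (indicator S))\<^sup>2 / (\<tau>\<^sub>0 * (1 - \<tau>\<^sub>1)) ^ card S"
  have "{\<alpha>. (\<forall>i. \<alpha> i \<in> {0, 1}) \<and> mi_size \<alpha> \<le> D}
      = (indicator :: 'n set \<Rightarrow> 'n \<Rightarrow> nat) ` {S. card S \<le> D}"
    by (auto simp only: zero_one_multi_index mi_size_indicator)
  hence R: "(\<Sum>\<alpha> | (\<forall>i. \<alpha> i \<in> {0, 1}) \<and> mi_size \<alpha> \<le> D.
        (r_coeff PX QX \<alpha>)\<^sup>2 / (\<tau>\<^sub>0 * (1 - \<tau>\<^sub>1)) ^ mi_size \<alpha>) = ?R"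
    by (simp only: sum.reindex[OF inj_on_subset[OF inj_indicator_nat subset_UNIV]] o_def mi_size_indicator)
  show ?thesis
    unfolding Adv_def R
  proof (rule SUP_least)
    fix f assume "f \<in> {f \<in> poly_deg_le D. (\<integral>y. (f y)\<^sup>2 \<partial>bern_mixture QX) \<noteq> 0}"
    hence f: "f \<in> poly_deg_le D" and nz: "(\<integral>y. (f y)\<^sup>2 \<partial>bern_mixture QX) \<noteq> 0" by auto
    have "0 \<le> (\<integral>y. (f y)\<^sup>2 \<partial>bern_mixture QX)" by simp
    with nz have pos: "0 < (\<integral>y. (f y)\<^sup>2 \<partial>bern_mixture QX)" by linarith
    \<comment> \<open>Taking the root needs no sign condition on the mean of \<open>f\<close>: a
      negative mean satisfies the bound as well.\<close>
    have "(\<integral>y. f y \<partial>bern_mixture PX) \<le> sqrt (?R * (\<integral>y. (f y)\<^sup>2 \<partial>bern_mixture QX))"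
      by (rule real_le_rsqrt[OF bern_mixture_advantage[OF assms f]])
    thus "ereal ((\<integral>y. f y \<partial>bern_mixture PX) / sqrt (\<integral>y. (f y)\<^sup>2 \<partial>bern_mixture QX)) \<le> ereal (sqrt ?R)"
      using pos by (simp add: real_sqrt_mult pos_divide_le_eq)
  qed
qed

end
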